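(* Let $A\in\mathbb{R}^{m\times n}$, let $K\subset\mathbb{R}^n$ be a closed convex cone with nonempty interior, let $\bar u\in\operatorname{int}(K^* )$, and let $S:=\{Ap:\bar u^Tp=1,\ p\in K\}$. Suppose that the system $Ax=0,\ \bar u^Tx=1,\ x\in K$ is feasible, and that $0\in\operatorname{int}(S)$. Suppose the generalized von Neumann algorithm described in the context is run with, at every iteration $i$, $p_{i+1}$ chosen as a minimizer $$p_{i+1}\in\arg\min_p\{p^TA^Ty_i:\ \bar u^Tp=1,\ p\in K\}$$ and with $C_{i+1}=\{Ap_0,Ap_1,\dots,Ap_{i+1}\}$ (all previously generated points are kept) and $y_{i+1}=P_{\operatorname{conv}(C_{i+1})}(0)$. Then the algorithm converges in finitely many iterations, i.e. there is a finite $i$ with $y_i=Ax_i=0$.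
   Context: $K^*:=\{z: z^Tx\ge 0\text{ for all }x\in K\}$ is the positive dual cone. $P_D(0)$ denotes the Euclidean projection of $0$ onto a closed convex set $D$, and $\operatorname{conv}$ the convex hull. The algorithm: choose $x_0=p_0\in\{x:\bar u^Tx=1,\ x\in K\}$ and set $y_0=Ax_0$, $i=0$. Given $y_i$, loop: find $p_{i+1}\in K$ with $\bar u^Tp_{i+1}=1$ and $p_{i+1}^TA^Ty_i\le 0$; if instead $p^TA^Ty_i>0$ for all $p\in K$ with $\bar u^Tp=1$, then exit (in that case $A^Ty_i\in\operatorname{int}(K^* )$). Let $C_{i+1}=\{Ac_{i+1,1},\dots,Ac_{i+1,k_{i+1}}\}$ be a finite subset of $\operatorname{conv}\{Ap_0,\dots,Ap_{i+1}\}$, and let $y_{i+1}=P_{\operatorname{conv}(\tilde C)}(0)=\sum_j\lambda_j^{(i+1)}Ac_{i+1,j}$ for some $\tilde C\subset C_{i+1}$, with $\lambda^{(i+1)}_j\ge 0$ and $\sum_j\lambda_j^{(i+1)}=1$; set $x_{i+1}=\sum_j\lambda^{(i+1)}_jc_{i+1,j}$ and increase $i$ by one. In the claim, $\tilde C=C_{i+1}$ and the algorithm stops when $y_i=0$ (or when it exits because $p^TA^Ty_i>0$ for all $p\in K$ with $\bar u^Tp=1$). *)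

theory Defs
  imports "HOL-Analysis.Analysis"
begin

definition dual_cone :: "(real^'n) set \<Rightarrow> (real^'n) set" where
  "dual_cone K = {z. \<forall>x\<in>K. 0 \<le> z \<bullet> x}"

definition cone_base :: "(real^'n) set \<Rightarrow> real^'n \<Rightarrow> (real^'n) set" where
  "cone_base K u = {p. u \<bullet> p = 1 \<and> p \<in> K}"

definition vN_exit :: "real^'n^'m \<Rightarrow> (real^'n) set \<Rightarrow> real^'n \<Rightarrow> real^'m \<Rightarrow> bool" where
  "vN_exit A K u v \<longleftrightarrow> (\<forall>p\<in>cone_base K u. 0 < p \<bullet> (transpose A *v v))"

text \<open>
  A run is described by total sequences, of which only the entries actually computed are meaningful.
  Entry \<open>i\<close> is computed if the algorithm did not stop at an earlier iterate, either because that
  iterate was zero or because the exit test succeeded there. Nothing is assumed about later entries.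
\<close>

definition vN_reached ::
    "real^'n^'m \<Rightarrow> (real^'n) set \<Rightarrow> real^'n \<Rightarrow> (nat \<Rightarrow> real^'m) \<Rightarrow> nat \<Rightarrow> bool" where
  "vN_reached A K u y i \<longleftrightarrow> (\<forall>j<i. y j \<noteq> 0 \<and> \<not> vN_exit A K u (y j))"

text \<open>
  The finite set \<open>C\<^sub>i\<close>, listed through the points \<open>c i 1, \<dots>, c i (k i)\<close>
  in the domain of \<open>A\<close>; repetitions are allowed.
\<close>

definition vN_C ::
    "real^'n^'m \<Rightarrow> (nat \<Rightarrow> nat) \<Rightarrow> (nat \<Rightarrow> nat \<Rightarrow> real^'n) \<Rightarrow> nat \<Rightarrow> (real^'m) set" where
  "vN_C A k c i = (\<lambda>j. A *v c i j) ` {1..k i}"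

text \<open>
  Here \<open>p\<close>, \<open>x\<close>, \<open>y\<close> are the generated points and iterates, \<open>D i\<close> is the subset of \<open>C\<^sub>i\<close> onto
  whose convex hull \<open>0\<close> is projected, and \<open>l i j\<close> are the convex weights. The sequences are
  arbitrary, so every admissible choice made by the algorithm is covered.
\<close>

definition vN_run ::
    "real^'n^'m \<Rightarrow> (real^'n) set \<Rightarrow> real^'n \<Rightarrow> (nat \<Rightarrow> real^'n) \<Rightarrow>
     (nat \<Rightarrow> nat) \<Rightarrow> (nat \<Rightarrow> nat \<Rightarrow> real^'n) \<Rightarrow> (nat \<Rightarrow> (real^'m) set) \<Rightarrow> (nat \<Rightarrow> nat \<Rightarrow> real) \<Rightarrow>
     (nat \<Rightarrow> real^'n) \<Rightarrow> (nat \<Rightarrow> real^'m) \<Rightarrow> bool" where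
  "vN_run A K u p k c D l x y \<longleftrightarrow>
     p 0 \<in> cone_base K u \<and> x 0 = p 0 \<and> y 0 = A *v x 0 \<and>
     (\<forall>i. vN_reached A K u y (Suc i) \<longrightarrow>
        p (Suc i) \<in> cone_base K u \<and>
        p (Suc i) \<bullet> (transpose A *v y i) \<le> 0 \<and>
        vN_C A k c (Suc i) \<subseteq> convex hull ((\<lambda>j. A *v p j) ` {0..Suc i}) \<and>
        D (Suc i) \<noteq> {} \<and> D (Suc i) \<subseteq> vN_C A k c (Suc i) \<and>
        y (Suc i) = closest_point (convex hull D (Suc i)) 0 \<and>
        (\<forall>j\<in>{1..k (Suc i)}. 0 \<le> l (Suc i) j) \<and>
        (\<Sum>j=1..k (Suc i). l (Suc i) j) = 1 \<and>
        y (Suc i) = (\<Sum>j=1..k (Suc i). l (Suc i) j *\<^sub>R (A *v c (Suc i) j)) \<and>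
        x (Suc i) = (\<Sum>j=1..k (Suc i). l (Suc i) j *\<^sub>R c (Suc i) j))"

end

theory Submission
  imports Defs
begin

text \<open>
  The idea is that each newly generated point lies at a fixed distance from all the earlier ones.
  Write \<open>s\<^sub>j = A p\<^sub>j\<close> and \<open>S\<close> for the image of the cone base, and let the ball of radius \<open>e\<close>
  around \<open>0\<close> be contained in \<open>S\<close>. If \<open>y\<^sub>i \<noteq> 0\<close>, then minimality of \<open>s\<^sub>i\<^sub>+\<^sub>1\<close> against the competitor
  \<open>- e y\<^sub>i / |y\<^sub>i|\<close> gives \<open>s\<^sub>i\<^sub>+\<^sub>1 \<bullet> y\<^sub>i \<le> - e |y\<^sub>i|\<close>. On the other hand \<open>y\<^sub>i\<close> is the point of minimal
  norm in the convex hull of \<open>s\<^sub>0, \<dots>, s\<^sub>i\<close>, so \<open>s\<^sub>j \<bullet> y\<^sub>i \<ge> 0\<close> for all \<open>j \<le> i\<close>. By Cauchy--Schwarz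
  \<open>s\<^sub>j\<close> and \<open>s\<^sub>i\<^sub>+\<^sub>1\<close> are at least \<open>e\<close> apart.

  An infinite run would thus produce an infinite sequence in \<open>S\<close> with pairwise distances at least
  \<open>e\<close>. This contradicts \<open>bounded_not_separated\<close>, since \<open>S\<close> is bounded: \<open>u\<close> is interior to the dual
  cone, so \<open>u \<bullet> q\<close> controls the norm of \<open>q\<close> on \<open>K\<close> (\<open>bounded_cone_base\<close>). Feasibility makes the
  exit test fail at every iterate, so a run can only stop at a zero iterate.
\<close>

lemma inner_transpose_mult:
  fixes A :: "real^'n^'m"
  shows "q \<bullet> (transpose A *v v) = (A *v q) \<bullet> v"
  by (metis dot_lmul_matrix inner_commute transpose_matrix_vector)

lemma bounded_cone_base:
  assumes "u \<in> interior (dual_cone K)"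
  shows "bounded (cone_base K u)"
proof -
  obtain e where e: "e > 0" "cball u e \<subseteq> dual_cone K"
    using assms by (auto simp: mem_interior_cball)
  have "norm q \<le> 1 / e" if q: "q \<in> cone_base K u" for q
  proof (cases "q = 0")
    case False
    \<comment> \<open>The worst perturbation of \<open>u\<close> inside the ball points against \<open>q\<close>.\<close>
    have "u - (e / norm q) *\<^sub>R q \<in> cball u e"
      using False e(1) by (simp add: dist_norm)
    then have "0 \<le> (u - (e / norm q) *\<^sub>R q) \<bullet> q"
      using e(2) q unfolding dual_cone_def cone_base_def by blast
    also have "\<dots> = 1 - e * norm q"
      using False q by (simp add: inner_diff_left cone_base_def power2_eq_square flip: power2_norm_eq_inner)
    finally show ?thesis
      using e(1) by (simp add: field_simps)
  qed (use e in simp)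
  then show ?thesis
    by (auto simp: bounded_iff)
qed

lemma bounded_not_separated:
  fixes s :: "nat \<Rightarrow> 'a::heine_borel"
  assumes "bounded (range s)" and "e > 0"
  shows "\<exists>i j. j < i \<and> dist (s j) (s i) < e"
proof -
  obtain L r where r: "strict_mono r" and L: "(s \<circ> r) \<longlonglongrightarrow> L"
    using bounded_imp_convergent_subsequence[OF assms(1)] by blast
  obtain N where "\<forall>m\<ge>N. \<forall>n\<ge>N. dist ((s \<circ> r) m) ((s \<circ> r) n) < e"
    using LIMSEQ_imp_Cauchy[OF L] assms(2) unfolding Cauchy_def by blast
  then have "dist (s (r N)) (s (r (Suc N))) < e"
    by simp
  moreover have "r N < r (Suc N)"
    using r by (simp add: strict_mono_less)
  ultimately show ?thesis
    by blast
qed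

text \<open>
  The variational inequality for the projection of the origin: moving from the point of
  minimal norm towards any other point of the set cannot decrease the norm to first order.
\<close>

lemma inner_closest_point_origin_ge:
  fixes S :: "'a::euclidean_space set"
  assumes "convex S" and "closed S" and "s \<in> S"
  shows "closest_point S 0 \<bullet> closest_point S 0 \<le> s \<bullet> closest_point S 0"
  using closest_point_dot[OF assms, of 0]
  by (simp add: inner_diff_right inner_commute)

lemma inner_min_le_neg_norm:
  fixes v :: "'a::real_inner"
  assumes "cball 0 e \<subseteq> S" and "0 \<le> e" and min: "\<And>s. s \<in> S \<Longrightarrow> t \<bullet> v \<le> s \<bullet> v"
  shows "t \<bullet> v \<le> - e * norm v"
proof (cases "v = 0")
  case False
  have "- (e / norm v) *\<^sub>R v \<in> S"
    using False assms(1,2) by (auto simp: subset_iff)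
  from min[OF this] show ?thesis
    using False by (simp add: power2_eq_square flip: power2_norm_eq_inner)
qed simp

lemma dist_ge_of_inner_gap:
  fixes v :: "'a::real_inner"
  assumes "v \<noteq> 0" and "t \<bullet> v \<le> - e * norm v" and "0 \<le> s \<bullet> v"
  shows "e \<le> dist s t"
proof -
  have "e * norm v \<le> (s - t) \<bullet> v"
    using assms(2,3) by (simp add: inner_diff_left)
  also have "\<dots> \<le> norm (s - t) * norm v"
    by (rule norm_cauchy_schwarz)
  finally show ?thesis
    using assms(1) by (simp add: dist_norm)
qed

text \<open>
  A feasible point gives the value zero in the exit test, so the strict inequality there fails.
\<close>

lemma not_vN_exit_if_feasible:
  assumes "A *v z = 0" and "u \<bullet> z = 1" and "z \<in> K"
  shows "\<not> vN_exit A K u v"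
  using assms unfolding vN_exit_def cone_base_def inner_transpose_mult by force

lemma vN_run_iterate_eq:
  assumes run: "vN_run A K u p k c D l x y" and "vN_reached A K u y i"
  shows "y i = A *v x i"
proof (cases i)
  case 0
  then show ?thesis
    using run by (simp add: vN_run_def)
next
  case (Suc i')
  then have "y i = (\<Sum>j=1..k i. l i j *\<^sub>R (A *v c i j))" "x i = (\<Sum>j=1..k i. l i j *\<^sub>R c i j)"
    using assms unfolding vN_run_def by blast+
  then show ?thesis
    by (simp add: linear_sum[OF matrix_vector_mul_linear] matrix_vector_mult_scaleR)
qed

theorem theorem3p3:
  fixes A :: "real^'n^'m" and K :: "(real^'n) set" and u :: "real^'n"
    and p :: "nat \<Rightarrow> real^'n" and k :: "nat \<Rightarrow> nat" and c :: "nat \<Rightarrow> nat \<Rightarrow> real^'n"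
    and D :: "nat \<Rightarrow> (real^'m) set" and l :: "nat \<Rightarrow> nat \<Rightarrow> real"
    and x :: "nat \<Rightarrow> real^'n" and y :: "nat \<Rightarrow> real^'m"
  assumes "closed K" and "convex_cone K" and "interior K \<noteq> {}"
    and "u \<in> interior (dual_cone K)"
    and feasible: "\<exists>z. A *v z = 0 \<and> u \<bullet> z = 1 \<and> z \<in> K"
    and "0 \<in> interior ((\<lambda>q. A *v q) ` cone_base K u)"
    and run: "vN_run A K u p k c D l x y"
    and argmin: "\<And>i. vN_reached A K u y (Suc i) \<Longrightarrow>
      is_arg_min (\<lambda>q. q \<bullet> (transpose A *v y i)) (\<lambda>q. q \<in> cone_base K u) (p (Suc i))"
    and keep_all: "\<And>i. vN_reached A K u y (Suc i) \<Longrightarrow>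
      vN_C A k c (Suc i) = (\<lambda>j. A *v p j) ` {0..Suc i}"
    and project_all: "\<And>i. vN_reached A K u y (Suc i) \<Longrightarrow> D (Suc i) = vN_C A k c (Suc i)"
  shows "\<exists>i. vN_reached A K u y i \<and> y i = A *v x i \<and> A *v x i = 0"
proof (rule ccontr)
  let ?s = "\<lambda>j. A *v p j"
  let ?S = "(\<lambda>q. A *v q) ` cone_base K u"
  assume neg: "\<not> ?thesis"
  have no_exit: "\<not> vN_exit A K u v" for v
    using feasible not_vN_exit_if_feasible by blast
  have reached: "vN_reached A K u y i" for i
  proof (induction i)
    case 0
    show ?case
      by (simp add: vN_reached_def)
  next
    case (Suc i)
    then have "y i \<noteq> 0"
      using neg vN_run_iterate_eq[OF run Suc] by metis
    with Suc no_exit show ?case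
      by (auto simp: vN_reached_def less_Suc_eq)
  qed
  have y_nz: "y i \<noteq> 0" for i
    using neg reached vN_run_iterate_eq[OF run reached] by metis
  have p_base: "p i \<in> cone_base K u" for i
    using run reached by (cases i) (auto simp: vN_run_def)
  have bounded: "bounded (range ?s)"
  proof (rule bounded_subset)
    show "bounded ?S"
      using bounded_cone_base[OF assms(4)]
      by (intro bounded_linear_image matrix_vector_mul_bounded_linear)
    show "range ?s \<subseteq> ?S"
      using p_base by blast
  qed
  obtain e where e: "e > 0" "cball 0 e \<subseteq> ?S"
    using assms(6) by (auto simp: mem_interior_cball)
  have new: "?s (Suc i) \<bullet> y i \<le> - e * norm (y i)" for i
  proof (rule inner_min_le_neg_norm[OF e(2)])
    show "?s (Suc i) \<bullet> y i \<le> s \<bullet> y i" if "s \<in> ?S" for s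
      using argmin[OF reached, of i] that unfolding is_arg_min_def inner_transpose_mult
      by (auto simp: not_less)
  qed (use e in simp)
  have old: "0 \<le> ?s j \<bullet> y i" if "j \<le> i" for i j
  proof (cases i)
    case 0
    then show ?thesis
      using run that by (simp add: vN_run_def)
  next
    case (Suc i')
    let ?H = "convex hull (?s ` {0..i})"
    have "y i = closest_point ?H 0"
      using run reached keep_all[OF reached] project_all[OF reached] Suc
      unfolding vN_run_def by metis
    moreover have "closed ?H"
      by (simp add: compact_convex_hull compact_imp_closed finite_imp_compact)
    moreover have "?s j \<in> ?H"
      using that by (simp add: hull_inc)
    ultimately have "y i \<bullet> y i \<le> ?s j \<bullet> y i"
      using inner_closest_point_origin_ge by (metis convex_convex_hull)
    then show ?thesis
      by (meson inner_ge_zero order_trans)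
  qed
  have "e \<le> dist (?s j) (?s i)" if "j < i" for i j
  proof -
    obtain i' where "i = Suc i'" "j \<le> i'"
      using \<open>j < i\<close> by (cases i) auto
    then show ?thesis
      using dist_ge_of_inner_gap[OF y_nz new old] by blast
  qed
  then show False
    using bounded_not_separated[OF bounded e(1)] by force
qed

end
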